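(* If $\phi\in H(\mathcal{SO})$ satisfies $\phi(\mathbf{1})=0$, then $\phi=\mathbf{0}$, i.e. $\phi(f)=0$ for every $f\in\mathcal{SO}$.
   Context: $\mathbb{H}=[0,\infty)$ carries the metric $|x-y|$. A continuous function $f:\mathbb{H}\to\mathbb{R}$ is slowly oscillating if for every $R>0$ and $\varepsilon>0$ there exists $M>0$ such that $\operatorname{diam} f([x,x+R])<\varepsilon$ for every $x>M$. $\mathcal{SO}$ denotes the set of all (possibly unbounded) real-valued slowly oscillating continuous functions on $\mathbb{H}$; it is a vector lattice under pointwise operations containing the constant function $\mathbf{1}$ with value $1$. A homomorphism $\phi:\mathcal{SO}\to\mathbb{R}$ is a linear map with $\phi(f\vee g)=\max(\phi(f),\phi(g))$ and $\phi(f\wedge g)=\min(\phi(f),\phi(g))$ for all $f,g\in\mathcal{SO}$ (the zero map is allowed). $H(\mathcal{SO})$ is the set of all homomorphisms. *)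

theory Defs
  imports "HOL-Analysis.Analysis"
begin

text \<open>
  Functions on the half-line are represented extensionally (the value outside is
  \<^const>\<open>undefined\<close>), so that equality of HOL functions is equality of functions on the
  half-line; correspondingly, the pointwise operations are restricted to it.
\<close>

definition halfline :: "real set" where
  "halfline = {0..}"

definition slowly_oscillating :: "(real \<Rightarrow> real) \<Rightarrow> bool" where
  "slowly_oscillating f \<longleftrightarrow>
     continuous_on halfline f \<and>
     (\<forall>R>0. \<forall>\<epsilon>>0. \<exists>M>0. \<forall>x>M. diameter (f ` {x..x + R}) < \<epsilon>)"

definition SO :: "(real \<Rightarrow> real) set" where
  "SO = {f \<in> halfline \<rightarrow>\<^sub>E UNIV. slowly_oscillating f}"

text \<open>
  Only the values of a homomorphism on \<^term>\<open>SO\<close> are constrained; its values elsewhere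
  are irrelevant, and equality to the zero map means vanishing on \<^term>\<open>SO\<close>.
\<close>

definition homs_SO :: "((real \<Rightarrow> real) \<Rightarrow> real) set" where
  "homs_SO = {\<phi>.
     (\<forall>f\<in>SO. \<forall>g\<in>SO. \<phi> (\<lambda>x\<in>halfline. f x + g x) = \<phi> f + \<phi> g) \<and>
     (\<forall>c. \<forall>f\<in>SO. \<phi> (\<lambda>x\<in>halfline. c * f x) = c * \<phi> f) \<and>
     (\<forall>f\<in>SO. \<forall>g\<in>SO. \<phi> (\<lambda>x\<in>halfline. max (f x) (g x)) = max (\<phi> f) (\<phi> g)) \<and>
     (\<forall>f\<in>SO. \<forall>g\<in>SO. \<phi> (\<lambda>x\<in>halfline. min (f x) (g x)) = min (\<phi> f) (\<phi> g))}"

end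

theory Submission
  imports Defs
begin

text \<open>
  Suppose \<open>f \<in> SO\<close>. It suffices to find \<open>g \<in> SO\<close> that dominates every multiple of \<open>f\<close> up to an
  additive constant, since \<open>\<phi>\<close> is monotone and kills constants, so that \<open>k * \<phi> f \<le> \<phi> g\<close> for
  all natural numbers \<open>k\<close>, whence \<open>\<phi> f \<le> 0\<close>,
  and likewise \<open>\<phi> (- f) \<le> 0\<close>. Take \<open>g = (\<Sum>j. max 0 (f - n j))\<close>, where
  \<open>n j\<close> is so large that \<open>f x > n j\<close> holds only for \<open>x\<close> so far out that \<open>f\<close> varies by at most
  \<open>(1/2) ^ j\<close> within distance \<open>j\<close> of \<open>x\<close>. Then for \<open>\<bar>x - y\<bar> \<le> J\<close> the terms with \<open>j \<ge> J\<close>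
  contribute at most \<open>2 * (1/2) ^ J\<close> to \<open>g x - g y\<close>, so \<open>g\<close> inherits continuity and slow oscillation
  from \<open>f\<close>.
\<close>

section \<open>Slow oscillation in two-point form\<close>

lemma slowly_oscillatingD:
  assumes f: "slowly_oscillating f" and "R > 0" "\<epsilon> > 0"
  obtains M where "M > 0"
    "\<And>x y. x > M \<Longrightarrow> y > M \<Longrightarrow> \<bar>x - y\<bar> \<le> R \<Longrightarrow> \<bar>f x - f y\<bar> < \<epsilon>"
proof -
  obtain M where "M > 0" and M: "\<And>x. x > M \<Longrightarrow> diameter (f ` {x..x + R}) < \<epsilon>"
    using assms unfolding slowly_oscillating_def by blast
  have "\<bar>f x - f y\<bar> < \<epsilon>" if "x > M" "y > M" "\<bar>x - y\<bar> \<le> R" for x y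
  proof -
    have "continuous_on {min x y..min x y + R} f"
      using f \<open>M > 0\<close> that continuous_on_subset[of halfline f]
      by (auto simp: slowly_oscillating_def halfline_def)
    \<comment> \<open>\<open>diameter\<close> controls distances only on bounded sets, so
      compactness of the interval is needed here.\<close>
    then have "bounded (f ` {min x y..min x y + R})"
      by (intro compact_imp_bounded compact_continuous_image) auto
    then have "dist (f x) (f y) \<le> diameter (f ` {min x y..min x y + R})"
      using that by (intro diameter_bounded_bound) auto
    also have "\<dots> < \<epsilon>"
      using that by (intro M) auto
    finally show ?thesis by (simp add: dist_real_def)
  qed
  with \<open>M > 0\<close> that show thesis by blast
qed

text \<open>Both continuity and slow oscillation pass from \<open>f\<close> to \<open>h\<close>:
  once \<open>L\<close> is fixed, the differences of \<open>f\<close> can be made small compared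
  with \<open>\<epsilon> / (L + 1)\<close>. It matters that \<open>L\<close> may depend on
  \<open>R\<close> and \<open>\<epsilon>\<close>, since it grows without bound in the main
  construction.\<close>

lemma restrict_in_SO:
  assumes f: "f \<in> SO"
    and h: "\<And>R \<epsilon>. R > 0 \<Longrightarrow> \<epsilon> > 0 \<Longrightarrow>
      \<exists>L\<ge>0. \<forall>x\<ge>0. \<forall>y\<ge>0. \<bar>x - y\<bar> \<le> R \<longrightarrow> \<bar>h x - h y\<bar> \<le> L * \<bar>f x - f y\<bar> + \<epsilon>"
  shows "restrict h halfline \<in> SO"
proof -
  have so: "slowly_oscillating f"
    using f by (simp add: SO_def)
  \<comment> \<open>\<open>L + 1\<close> keeps the quotient meaningful for \<open>L = 0\<close>;
    aiming at \<open>\<epsilon> / 2\<close> leaves room for the non-strict bound that passes to a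
    diameter.\<close>
  have small: "L * d + \<epsilon> / 4 < \<epsilon> / 2" if "L \<ge> 0" "\<epsilon> > 0" "d < \<epsilon> / (4 * (L + 1))" "d \<ge> 0"
    for L d \<epsilon> :: real
  proof -
    have "d * (4 * (L + 1)) < \<epsilon>"
      using that by (simp add: pos_less_divide_eq)
    then show ?thesis
      using that by (simp add: algebra_simps)
  qed
  have "continuous_on halfline h"
    unfolding continuous_on_iff
  proof (intro ballI allI impI)
    fix x \<epsilon> :: real
    assume x: "x \<in> halfline" and "\<epsilon> > 0"
    then obtain L where "L \<ge> 0"
      and L: "\<And>x y. x \<ge> 0 \<Longrightarrow> y \<ge> 0 \<Longrightarrow> \<bar>x - y\<bar> \<le> 1 \<Longrightarrow> \<bar>h x - h y\<bar> \<le> L * \<bar>f x - f y\<bar> + \<epsilon> / 4"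
      using h[of 1 "\<epsilon> / 4"] by auto
    have "\<epsilon> / (4 * (L + 1)) > 0"
      using \<open>L \<ge> 0\<close> \<open>\<epsilon> > 0\<close> by simp
    then obtain d where "d > 0"
      and d: "\<And>y. y \<in> halfline \<Longrightarrow> dist y x < d \<Longrightarrow> dist (f y) (f x) < \<epsilon> / (4 * (L + 1))"
      using so x unfolding slowly_oscillating_def continuous_on_iff by blast
    have "dist (h y) (h x) < \<epsilon>" if "y \<in> halfline" "dist y x < min d 1" for y
    proof -
      have "\<bar>h y - h x\<bar> \<le> L * \<bar>f y - f x\<bar> + \<epsilon> / 4"
        using that x by (intro L) (auto simp: halfline_def dist_real_def)
      also have "\<dots> < \<epsilon> / 2"
        using d[of y] that \<open>L \<ge> 0\<close> \<open>\<epsilon> > 0\<close> by (intro small) (auto simp: dist_real_def)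
      finally show ?thesis using \<open>\<epsilon> > 0\<close> by (simp add: dist_real_def)
    qed
    then show "\<exists>d>0. \<forall>y\<in>halfline. dist y x < d \<longrightarrow> dist (h y) (h x) < \<epsilon>"
      using \<open>d > 0\<close> by (intro exI[of _ "min d 1"]) auto
  qed
  moreover have "\<exists>M>0. \<forall>x>M. diameter (restrict h halfline ` {x..x + R}) < \<epsilon>"
    if "R > 0" "\<epsilon> > 0" for R \<epsilon>
  proof -
    obtain L where "L \<ge> 0"
      and L: "\<And>x y. x \<ge> 0 \<Longrightarrow> y \<ge> 0 \<Longrightarrow> \<bar>x - y\<bar> \<le> R \<Longrightarrow> \<bar>h x - h y\<bar> \<le> L * \<bar>f x - f y\<bar> + \<epsilon> / 4"
      using h[OF \<open>R > 0\<close>, of "\<epsilon> / 4"] \<open>\<epsilon> > 0\<close> by auto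
    have "\<epsilon> / (4 * (L + 1)) > 0"
      using \<open>L \<ge> 0\<close> \<open>\<epsilon> > 0\<close> by simp
    then obtain M where "M > 0"
      and M: "\<And>x y. x > M \<Longrightarrow> y > M \<Longrightarrow> \<bar>x - y\<bar> \<le> R \<Longrightarrow> \<bar>f x - f y\<bar> < \<epsilon> / (4 * (L + 1))"
      using slowly_oscillatingD[OF so \<open>R > 0\<close>] by metis
    have "diameter (restrict h halfline ` {x..x + R}) < \<epsilon>" if "x > M" for x
    proof -
      have img: "restrict h halfline ` {x..x + R} = h ` {x..x + R}"
        using that \<open>M > 0\<close> by (intro image_cong) (auto simp: halfline_def)
      have "\<bar>h s - h t\<bar> \<le> \<epsilon> / 2" if "s \<in> {x..x + R}" "t \<in> {x..x + R}" for s t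
      proof -
        have "\<bar>h s - h t\<bar> \<le> L * \<bar>f s - f t\<bar> + \<epsilon> / 4"
          using that \<open>x > M\<close> \<open>M > 0\<close> by (intro L) auto
        also have "\<dots> < \<epsilon> / 2"
          using M[of s t] that \<open>x > M\<close> \<open>L \<ge> 0\<close> \<open>\<epsilon> > 0\<close> by (intro small) auto
        finally show ?thesis by simp
      qed
      then have "diameter (h ` {x..x + R}) \<le> \<epsilon> / 2"
        using \<open>\<epsilon> > 0\<close> by (intro diameter_le) auto
      then show ?thesis
        unfolding img using \<open>\<epsilon> > 0\<close> by simp
    qed
    with \<open>M > 0\<close> show ?thesis by (intro exI[of _ M] conjI allI impI)
  qed
  ultimately show ?thesis
    by (auto simp: SO_def slowly_oscillating_def cong: continuous_on_cong)
qed

lemma affine_in_SO: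
  assumes "f \<in> SO"
  shows "(\<lambda>x\<in>halfline. a * f x + b) \<in> SO"
proof (rule restrict_in_SO[OF assms])
  fix R \<epsilon> :: real
  assume "\<epsilon> > 0"
  have "\<bar>(a * f x + b) - (a * f y + b)\<bar> \<le> \<bar>a\<bar> * \<bar>f x - f y\<bar> + \<epsilon>" for x y
    using \<open>\<epsilon> > 0\<close> by (simp add: abs_mult flip: right_diff_distrib)
  then show "\<exists>L\<ge>0. \<forall>x\<ge>0. \<forall>y\<ge>0. \<bar>x - y\<bar> \<le> R \<longrightarrow>
      \<bar>(a * f x + b) - (a * f y + b)\<bar> \<le> L * \<bar>f x - f y\<bar> + \<epsilon>"
    by (intro exI[of _ "\<bar>a\<bar>"]) auto
qed

section \<open>Construction of the dominating function\<close>

text \<open>By compactness \<open>f\<close> is bounded on every initial interval, so a large enough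
  value of \<open>f\<close> forces \<open>x\<close> so far out that its whole neighbourhood lies
  where \<open>f\<close> oscillates little.\<close>

lemma SO_small_variation_where_large:
  assumes f: "f \<in> SO" and "\<epsilon> > 0"
  shows "\<exists>n\<ge>c. \<forall>x\<ge>0. \<forall>y\<ge>0. \<bar>x - y\<bar> \<le> R \<longrightarrow> f x > n \<longrightarrow> \<bar>f x - f y\<bar> < \<epsilon>"
proof -
  \<comment> \<open>The case \<open>R = 0\<close> occurs later, whereas slow oscillation speaks of
    positive lengths only.\<close>
  define R' where "R' = max R 1"
  have "R' > 0"
    by (simp add: R'_def)
  have so: "slowly_oscillating f"
    using f by (simp add: SO_def)
  obtain M where "M > 0"
    and M: "\<And>x y. x > M \<Longrightarrow> y > M \<Longrightarrow> \<bar>x - y\<bar> \<le> R' \<Longrightarrow> \<bar>f x - f y\<bar> < \<epsilon>"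
    using slowly_oscillatingD[OF so \<open>R' > 0\<close> \<open>\<epsilon> > 0\<close>] by metis
  have "continuous_on {0..M + R'} f"
    using so continuous_on_subset[of halfline f] by (auto simp: slowly_oscillating_def halfline_def)
  then have "bounded (f ` {0..M + R'})"
    by (intro compact_imp_bounded compact_continuous_image) auto
  then obtain B where B: "\<And>x. 0 \<le> x \<Longrightarrow> x \<le> M + R' \<Longrightarrow> \<bar>f x\<bar> \<le> B"
    unfolding bounded_iff by (metis atLeastAtMost_iff imageI real_norm_def)
  have "\<bar>f x - f y\<bar> < \<epsilon>" if "x \<ge> 0" "\<bar>x - y\<bar> \<le> R" "f x > max c B" for x y
  proof -
    have "x > M + R'"
      using B[of x] that by linarith
    then show ?thesis
      using that by (intro M) (auto simp: R'_def)
  qed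
  then show ?thesis
    by (intro exI[of _ "max c B"]) auto
qed

lemma SO_dominates_multiples:
  assumes f: "f \<in> SO"
  obtains g where "restrict g halfline \<in> SO"
    "\<And>k::nat. \<exists>C. \<forall>x. real k * f x - C \<le> g x"
proof -
  have "\<exists>n. \<forall>j::nat. n j \<ge> real j \<and>
      (\<forall>x\<ge>0. \<forall>y\<ge>0. \<bar>x - y\<bar> \<le> real j \<longrightarrow> f x > n j \<longrightarrow> \<bar>f x - f y\<bar> < (1/2) ^ j)"
    using SO_small_variation_where_large[OF f] by (intro choice allI) simp
  then obtain n :: "nat \<Rightarrow> real" where n: "\<And>j. n j \<ge> real j"
    and near: "\<And>j x y. x \<ge> 0 \<Longrightarrow> y \<ge> 0 \<Longrightarrow> \<bar>x - y\<bar> \<le> real j \<Longrightarrow> f x > n j \<Longrightarrow> \<bar>f x - f y\<bar> < (1/2) ^ j"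
    by blast
  define t where "t j x = max 0 (f x - n j)" for j x
  \<comment> \<open>Since \<open>n j \<ge> real j\<close>, the terms with \<open>j \<ge> f x\<close>
    vanish, so this finite sum is the whole series.\<close>
  define g where "g x = (\<Sum>j<nat \<lceil>f x\<rceil>. t j x)" for x
  have g_eq: "g x = (\<Sum>j<N. t j x)" if "f x \<le> real N" for x N
    unfolding g_def
  proof (intro sum.mono_neutral_left)
    have "t j x = 0" if "nat \<lceil>f x\<rceil> \<le> j" for j
    proof -
      have "f x \<le> real j"
        using that by linarith
      then show ?thesis
        using n[of j] by (simp add: t_def)
    qed
    then show "\<forall>j\<in>{..<N} - {..<nat \<lceil>f x\<rceil>}. t j x = 0"
      by auto
    show "{..<nat \<lceil>f x\<rceil>} \<subseteq> {..<N}"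
      using that by auto
  qed auto
  have t_diff: "\<bar>t j x - t j y\<bar> \<le> \<bar>f x - f y\<bar>" for j x y
    by (auto simp: t_def max_def)
  have t_far: "\<bar>t j x - t j y\<bar> \<le> (1/2) ^ j" if "x \<ge> 0" "y \<ge> 0" "\<bar>x - y\<bar> \<le> real j" for j x y
  proof (cases "f x > n j \<or> f y > n j")
    case True
    then have "\<bar>f x - f y\<bar> < (1/2) ^ j"
      using near[of x y j] near[of y x j] that by (auto simp: abs_minus_commute)
    then show ?thesis
      using t_diff[of j x y] by linarith
  qed (auto simp: t_def)
  \<comment> \<open>The first \<open>J\<close> terms vary no more than \<open>f\<close> does; for
    \<open>j \<ge> J\<close> the points are within distance \<open>j\<close>, so
    \<open>t_far\<close> gives a geometric tail.\<close>
  have g_diff: "\<bar>g x - g y\<bar> \<le> real J * \<bar>f x - f y\<bar> + 2 * (1/2) ^ J"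
    if "x \<ge> 0" "y \<ge> 0" "\<bar>x - y\<bar> \<le> real J" for x y J
  proof -
    \<comment> \<open>One \<open>N\<close> serves both points, and \<open>N \<ge> J\<close> allows
      the split at \<open>J\<close>.\<close>
    obtain N :: nat where N: "max (max (f x) (f y)) (real J) \<le> real N"
      using real_arch_simple by blast
    have "\<bar>g x - g y\<bar> = \<bar>\<Sum>j<N. t j x - t j y\<bar>"
      using N by (simp add: g_eq[of _ N] sum_subtractf)
    also have "\<dots> \<le> (\<Sum>j<N. \<bar>t j x - t j y\<bar>)"
      by (rule sum_abs)
    also have "\<dots> = (\<Sum>j<J. \<bar>t j x - t j y\<bar>) + (\<Sum>j=J..<N. \<bar>t j x - t j y\<bar>)"
      using N by (simp add: sum.atLeastLessThan_concat flip: atLeast0LessThan)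
    also have "\<dots> \<le> (\<Sum>j<J. \<bar>f x - f y\<bar>) + (\<Sum>j=J..<N. (1/2) ^ j)"
      using that by (intro add_mono sum_mono t_diff t_far) auto
    \<comment> \<open>The sum telescopes, as
      \<open>(1/2) ^ j = 2 * (1/2) ^ j - 2 * (1/2) ^ Suc j\<close>.\<close>
    also have "(\<Sum>j=J..<N. (1/2) ^ j) = 2 * (1/2::real) ^ J - 2 * (1/2) ^ N"
      using sum_Suc_diff'[of J N "\<lambda>j. - 2 * (1/2::real) ^ j"] N by simp
    also have "\<dots> \<le> 2 * (1/2) ^ J"
      by simp
    finally show ?thesis by simp
  qed
  have "restrict g halfline \<in> SO"
  proof (rule restrict_in_SO[OF f])
    fix R \<epsilon> :: real
    assume "R > 0" "\<epsilon> > 0"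
    obtain J1 :: nat where J1: "R \<le> real J1"
      using real_arch_simple by blast
    obtain J2 :: nat where J2: "(1/2) ^ J2 < \<epsilon> / 2"
      using real_arch_pow_inv[of "\<epsilon> / 2" "1/2"] \<open>\<epsilon> > 0\<close> by auto
    define J where "J = max J1 J2"
    have "(1/2::real) ^ J \<le> (1/2) ^ J2"
      by (intro power_decreasing) (auto simp: J_def)
    then have J: "2 * (1/2) ^ J \<le> \<epsilon>"
      using J2 by linarith
    have "\<bar>g x - g y\<bar> \<le> real J * \<bar>f x - f y\<bar> + \<epsilon>" if "x \<ge> 0" "y \<ge> 0" "\<bar>x - y\<bar> \<le> R" for x y
    proof -
      have "\<bar>x - y\<bar> \<le> real J"
        using that J1 by (simp add: J_def)
      then show ?thesis
        using g_diff[of x y J] that J by linarith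
    qed
    then show "\<exists>L\<ge>0. \<forall>x\<ge>0. \<forall>y\<ge>0. \<bar>x - y\<bar> \<le> R \<longrightarrow> \<bar>g x - g y\<bar> \<le> L * \<bar>f x - f y\<bar> + \<epsilon>"
      by (intro exI[of _ "real J"]) auto
  qed
  moreover have "\<exists>C. \<forall>x. real k * f x - C \<le> g x" for k :: nat
  \<comment> \<open>The first \<open>k\<close> terms already suffice: each is at least
    \<open>f x - n j\<close>, and the remaining ones are nonnegative.\<close>
  proof (intro exI[of _ "\<Sum>j<k. n j"] allI)
    fix x
    obtain N :: nat where N: "max (f x) (real k) \<le> real N"
      using real_arch_simple by blast
    have "real k * f x - (\<Sum>j<k. n j) = (\<Sum>j<k. f x - n j)"
      by (simp add: sum_subtractf)
    also have "\<dots> \<le> (\<Sum>j<k. t j x)"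
      by (intro sum_mono) (simp add: t_def)
    also have "\<dots> \<le> (\<Sum>j<N. t j x)"
      using N by (intro sum_mono2) (auto simp: t_def)
    also have "\<dots> = g x"
      using N by (simp add: g_eq[of x N])
    finally show "real k * f x - (\<Sum>j<k. n j) \<le> g x" .
  qed
  ultimately show thesis using that by blast
qed

section \<open>Homomorphisms that vanish on constants\<close>

text \<open>Pointwise order means that the join is \<open>g\<close> itself, an equality of HOL
  functions because \<open>g\<close> is extensional.\<close>

lemma homs_SO_mono:
  assumes \<phi>: "\<phi> \<in> homs_SO" and "f \<in> SO" "g \<in> SO" and "\<And>x. x \<in> halfline \<Longrightarrow> f x \<le> g x"
  shows "\<phi> f \<le> \<phi> g"
proof -
  have "(\<lambda>x\<in>halfline. max (f x) (g x)) = g"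
    using assms by (auto simp: SO_def PiE_def extensional_def fun_eq_iff)
  moreover have "\<phi> (\<lambda>x\<in>halfline. max (f x) (g x)) = max (\<phi> f) (\<phi> g)"
    using assms by (simp add: homs_SO_def)
  ultimately show ?thesis by simp
qed

lemma homs_SO_affine:
  assumes \<phi>: "\<phi> \<in> homs_SO" and f: "f \<in> SO"
  shows "\<phi> (\<lambda>x\<in>halfline. a * f x + b) = a * \<phi> f + b * \<phi> (\<lambda>x\<in>halfline. 1)"
proof -
  have one: "(\<lambda>x\<in>halfline. 1) \<in> SO" and af: "(\<lambda>x\<in>halfline. a * f x) \<in> SO"
    using affine_in_SO[OF f, of 0 1] affine_in_SO[OF f, of a 0] by simp_all
  have b: "(\<lambda>x\<in>halfline. b * (\<lambda>x\<in>halfline. 1) x) \<in> SO"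
    using affine_in_SO[OF one, of b 0] by simp
  have eq: "(\<lambda>x\<in>halfline. a * f x + b) =
      (\<lambda>x\<in>halfline. (\<lambda>x\<in>halfline. a * f x) x + (\<lambda>x\<in>halfline. b * (\<lambda>x\<in>halfline. 1) x) x)"
    by (auto simp: fun_eq_iff)
  have "\<phi> (\<lambda>x\<in>halfline. a * f x + b) = \<phi> (\<lambda>x\<in>halfline. a * f x) + \<phi> (\<lambda>x\<in>halfline. b * (\<lambda>x\<in>halfline. 1) x)"
    unfolding eq using \<phi> af b unfolding homs_SO_def by blast
  also have "\<phi> (\<lambda>x\<in>halfline. a * f x) = a * \<phi> f"
    using \<phi> f unfolding homs_SO_def by blast
  also have "\<phi> (\<lambda>x\<in>halfline. b * (\<lambda>x\<in>halfline. 1) x) = b * \<phi> (\<lambda>x\<in>halfline. 1)"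
    using \<phi> one unfolding homs_SO_def by blast
  finally show ?thesis .
qed

lemma homs_SO_nonpos:
  assumes \<phi>: "\<phi> \<in> homs_SO" and one: "\<phi> (\<lambda>x\<in>halfline. 1) = 0" and f: "f \<in> SO"
  shows "\<phi> f \<le> 0"
proof (rule ccontr)
  assume "\<not> \<phi> f \<le> 0"
  obtain g where g: "restrict g halfline \<in> SO"
    and dom: "\<And>k::nat. \<exists>C. \<forall>x. real k * f x - C \<le> g x"
    using SO_dominates_multiples[OF f] by blast
  have "real k * \<phi> f \<le> \<phi> (restrict g halfline)" for k :: nat
  proof -
    obtain C where C: "\<And>x. real k * f x - C \<le> g x"
      using dom by blast
    have "\<phi> (\<lambda>x\<in>halfline. real k * f x + - C) \<le> \<phi> (restrict g halfline)"
      using C by (intro homs_SO_mono[OF \<phi>] affine_in_SO f g) auto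
    \<comment> \<open>\<open>C\<close> depends on \<open>k\<close>, but \<open>\<phi>\<close> kills
      constants, so the bound \<open>\<phi> (restrict g halfline)\<close> is the same for all
      \<open>k\<close>.\<close>
    then show ?thesis
      unfolding homs_SO_affine[OF \<phi> f] one by simp
  qed
  moreover obtain k :: nat where "\<phi> (restrict g halfline) < real k * \<phi> f"
    using reals_Archimedean3 \<open>\<not> \<phi> f \<le> 0\<close> by (meson not_le)
  ultimately show False
    by (meson not_le)
qed

theorem proposition3p9:
  fixes \<phi> :: "(real \<Rightarrow> real) \<Rightarrow> real"
  assumes "\<phi> \<in> homs_SO"
    and "\<phi> (\<lambda>x\<in>halfline. 1) = 0"
  shows "\<forall>f\<in>SO. \<phi> f = 0"
proof
  fix f assume f: "f \<in> SO"
  have "\<phi> (\<lambda>x\<in>halfline. (- 1) * f x + 0) \<le> 0"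
    by (rule homs_SO_nonpos[OF assms affine_in_SO[OF f]])
  then have "\<phi> f \<ge> 0"
    unfolding homs_SO_affine[OF assms(1) f] by simp
  with homs_SO_nonpos[OF assms f] show "\<phi> f = 0" by simp
qed

end
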